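(* For any positive integer $n$, \[ \sum_{S\subseteq\{0,\dots,n-1\}}|S-S| = 2^n(2n-7)+O\big(n\,6^{n/3}\big), \] where the implied constant is absolute.
   Context: $S-S=\{s_1-s_2: s_1,s_2\in S\}$; the sum runs over all $2^n$ subsets $S$, including the empty set (for which $|S-S|=0$). *)

theory Defs
  imports Complex_Main
begin

text \<open>The Minkowski difference set (the library's \<open>A - B\<close> on sets is set subtraction).
  Elements are integers, so negative differences are counted.\<close>

definition difference_set :: "int set \<Rightarrow> int set" where
  "difference_set S = {s1 - s2 | s1 s2. s1 \<in> S \<and> s2 \<in> S}"

end

theory Submission
  imports Defs
begin

text \<open>Exchanging the order of summation, the sum is
  \<open>(2 * n - 1) * 2 ^ n - 1 - 2 * (\<Sum>k = 1..n - 1. M k)\<close>, where \<open>M k\<close> is the number of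
  sets \<open>S\<close> with \<open>k \<notin> S - S\<close>. A family of \<open>p\<close> disjoint pairs \<open>{x, x + k}\<close> is avoided by exactly
  \<open>3 ^ p * 2 ^ (n - 2 * p)\<close> sets. If \<open>2 * k \<ge> n\<close>, all pairs are disjoint and
  \<open>M k = 2 ^ n * (3/4) ^ (n - k)\<close>. If \<open>2 * k \<le> n\<close>, the pairs with \<open>x mod (2 * k) < k\<close> are
  disjoint and there are at least \<open>n / 3\<close> of them, so both \<open>M k\<close> and
  \<open>2 ^ n * (3/4) ^ (n - k)\<close> are at most \<open>2 ^ n * (3/4) ^ (n / 3) = 6 ^ (n / 3)\<close>. The geometric
  series \<open>\<Sum>j \<ge> 1. (3/4) ^ j = 3\<close> then turns \<open>2 * n - 1\<close> into \<open>2 * n - 7\<close>.\<close>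

section \<open>Counting subsets that avoid disjoint pairs\<close>

text \<open>Induction on \<open>P\<close>: a new pair \<open>{x, k + x}\<close> triples the count,
  since an admissible set may be left alone or receive exactly one of the two points. Points of
  \<open>B\<close> are unconstrained and give a factor 2 each.\<close>

lemma card_subsets_avoiding_disjoint_pairs:
  fixes k :: "'a::ab_group_add"
  assumes "finite P" "finite B"
    and "P \<inter> (+) k ` P = {}" "B \<inter> (P \<union> (+) k ` P) = {}"
  shows "card {S \<in> Pow (P \<union> (+) k ` P \<union> B). \<forall>x\<in>P. \<not> (x \<in> S \<and> k + x \<in> S)}
    = 3 ^ card P * 2 ^ card B"
  using assms(1,3,4)
proof (induction P rule: finite_induct)
  case empty
  then show ?case using assms(2) by (simp add: card_Pow Collect_conj_eq flip: Pow_def)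
next
  case (insert x P)
  define U where "U = P \<union> (+) k ` P \<union> B"
  define F where "F = {S \<in> Pow U. \<forall>x\<in>P. \<not> (x \<in> S \<and> k + x \<in> S)}"
  have F: "card F = 3 ^ card P * 2 ^ card B"
    unfolding F_def U_def using insert.prems by (intro insert.IH) auto
  have finU: "finite U" using insert.hyps assms(2) by (simp add: U_def)
  have finF: "finite F" by (rule finite_subset[of _ "Pow U"]) (auto simp: F_def finU)
  have xk: "x \<noteq> k + x" "x \<notin> U" "k + x \<notin> U"
    using insert.prems insert.hyps by (auto simp: U_def)
  have "{S \<in> Pow (insert x P \<union> (+) k ` insert x P \<union> B).
        \<forall>y\<in>insert x P. \<not> (y \<in> S \<and> k + y \<in> S)}
      = F \<union> insert x ` F \<union> insert (k + x) ` F" (is "?L = ?R")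
  proof (intro equalityI subsetI)
    fix S assume S: "S \<in> ?L"
    define T where "T = S - {x, k + x}"
    have "T \<in> F" using S by (auto simp: T_def F_def U_def)
    moreover have "S = T \<or> S = insert x T \<or> S = insert (k + x) T"
      using S by (auto simp: T_def)
    ultimately show "S \<in> ?R" by blast
  next
    fix S assume S: "S \<in> ?R"
    then obtain T where T: "T \<in> F" "S = T \<or> S = insert x T \<or> S = insert (k + x) T" by blast
    have "T \<subseteq> U" using T by (auto simp: F_def)
    then have TX: "x \<notin> T" "k + x \<notin> T" using xk by auto
    have "S \<subseteq> insert x P \<union> (+) k ` insert x P \<union> B"
      using T \<open>T \<subseteq> U\<close> by (auto simp: U_def)
    moreover have "\<not> (y \<in> S \<and> k + y \<in> S)" if "y \<in> insert x P" for y
    proof (cases "y = x")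
      case True
      then show ?thesis using T(2) TX xk by auto
    next
      case False
      with that have y: "y \<in> P" by simp
      then have "y \<in> U" "k + y \<in> U" by (auto simp: U_def)
      moreover have "\<not> (y \<in> T \<and> k + y \<in> T)" using T(1) y by (auto simp: F_def)
      ultimately show ?thesis using T(2) xk by auto
    qed
    ultimately show "S \<in> ?L" by blast
  qed
  moreover have "card ?R = 3 * card F"
  proof -
    \<comment> \<open>Members of \<open>F\<close> miss both new points, so the three pieces are told
      apart by which new point they contain, and both insertions are injective on
      \<open>F\<close>.\<close>
    have notin: "x \<notin> T" "k + x \<notin> T" if "T \<in> F" for T
      using that xk by (auto simp: F_def)
    have inj: "inj_on (insert x) F" "inj_on (insert (k + x)) F"
      using notin by (auto intro!: inj_onI simp: insert_ident)
    have "F \<inter> insert x ` F = {}" "(F \<union> insert x ` F) \<inter> insert (k + x) ` F = {}"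
      using notin xk(1) by (auto, metis insertE insertI1)
    then show ?thesis using finF inj by (simp add: card_Un_disjoint card_image)
  qed
  ultimately show ?case using F insert.hyps by simp
qed

section \<open>Sets avoiding a given difference, and their number\<close>

lemma uminus_in_difference_set_iff: "- d \<in> difference_set S \<longleftrightarrow> d \<in> difference_set S"
  unfolding difference_set_def by (auto; metis minus_diff_eq minus_minus)

lemma in_difference_set_iff: "d \<in> difference_set S \<longleftrightarrow> (\<exists>x. x \<in> S \<and> d + x \<in> S)"
  unfolding difference_set_def by (auto, metis add.commute add_diff_cancel_left' diff_add_cancel)

text \<open>The family counted by \<open>M k\<close> in the overview; \<open>k\<close> is an integer
  so that differences of both signs are covered.\<close>

definition difference_free :: "nat \<Rightarrow> int \<Rightarrow> int set set" where
  "difference_free n k = {S \<in> Pow {0..int n - 1}. k \<notin> difference_set S}"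

lemma finite_difference_free: "finite (difference_free n k)"
  by (rule finite_subset[of _ "Pow {0..int n - 1}"]) (auto simp: difference_free_def)

lemma difference_free_uminus: "difference_free n (- k) = difference_free n k"
  by (simp add: difference_free_def uminus_in_difference_set_iff)

lemma difference_free_0: "difference_free n 0 = {{}}"
  by (auto simp: difference_free_def in_difference_set_iff)

lemma difference_free_eq:
  "difference_free n k = {S \<in> Pow {0..int n - 1}. \<forall>x. \<not> (x \<in> S \<and> k + x \<in> S)}"
  by (auto simp: difference_free_def in_difference_set_iff)

lemma three_pow_two_pow: "3 ^ p * 2 ^ (n - 2 * p) = 2 ^ n * (3/4 :: real) ^ p" if "2 * p \<le> n"
proof -
  have "(2::real) ^ n = 2 ^ (n - 2 * p) * 4 ^ p"
  proof -
    have "(4::real) ^ p = 2 ^ (2 * p)" by (simp add: power_mult)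
    then show ?thesis using that by (simp flip: power_add)
  qed
  then show ?thesis by (simp add: power_divide)
qed

text \<open>Each pair rules out one of its four configurations, hence a factor 3/4 per pair relative
  to all \<open>2 ^ n\<close> sets.\<close>

lemma card_avoiding_pairs_interval:
  assumes P: "P \<subseteq> {0..int n - 1}" "(+) k ` P \<subseteq> {0..int n - 1}" "P \<inter> (+) k ` P = {}"
  shows "real (card {S \<in> Pow {0..int n - 1}. \<forall>x\<in>P. \<not> (x \<in> S \<and> k + x \<in> S)})
    = 2 ^ n * (3/4) ^ card P"
proof -
  define B where "B = {0..int n - 1} - (P \<union> (+) k ` P)"
  have finP: "finite P" using P(1) finite_subset by blast
  have cPP: "card (P \<union> (+) k ` P) = 2 * card P"
    using finP P(3) by (simp add: card_Un_disjoint card_image)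
  have le: "2 * card P \<le> n"
    using card_mono[of "{0..int n - 1}" "P \<union> (+) k ` P"] P(1,2) cPP by simp
  have cB: "card B = n - 2 * card P"
    unfolding B_def using P(1,2) finP cPP by (subst card_Diff_subset) auto
  have U: "{0..int n - 1} = P \<union> (+) k ` P \<union> B" using P(1,2) by (auto simp: B_def)
  have "card {S \<in> Pow {0..int n - 1}. \<forall>x\<in>P. \<not> (x \<in> S \<and> k + x \<in> S)}
      = 3 ^ card P * 2 ^ card B"
    unfolding U by (rule card_subsets_avoiding_disjoint_pairs) (use finP P(3) in \<open>auto simp: B_def\<close>)
  then show ?thesis using le by (simp add: cB three_pow_two_pow)
qed

text \<open>The pairs inside the interval start at the \<open>n - k\<close> points of
  \<open>?P\<close>. As \<open>n - k \<le> k\<close>, all first points lie below \<open>k\<close>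
  and all second points do not, so no two pairs meet.\<close>

lemma card_difference_free_large:
  assumes "n \<le> 2 * k" "k < n"
  shows "real (card (difference_free n (int k))) = 2 ^ n * (3/4) ^ (n - k)"
proof -
  let ?P = "{0..int n - int k - 1}"
  have "difference_free n (int k)
      = {S \<in> Pow {0..int n - 1}. \<forall>x\<in>?P. \<not> (x \<in> S \<and> int k + x \<in> S)}"
    unfolding difference_free_eq by force
  moreover have "?P \<inter> (+) (int k) ` ?P = {}" using assms by auto
  then have "real (card {S \<in> Pow {0..int n - 1}. \<forall>x\<in>?P. \<not> (x \<in> S \<and> int k + x \<in> S)})
      = 2 ^ n * (3/4) ^ card ?P"
    by (intro card_avoiding_pairs_interval) auto
  moreover have "card ?P = n - k" using assms by simp
  ultimately show ?thesis by simp
qed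

text \<open>The base 6 arises here: \<open>2 ^ n\<close> is the power of 8 with exponent
  \<open>n / 3\<close>, and 8 * 3/4 = 6.\<close>

lemma two_pow_three_quarters_le:
  assumes "n \<le> 3 * p"
  shows "2 ^ n * (3/4 :: real) ^ p \<le> 6 powr (real n / 3)"
proof -
  have "(3/4 :: real) ^ p = (3/4) powr real p" by (simp add: powr_realpow)
  also have "\<dots> \<le> (3/4) powr (real n / 3)"
    using assms by (intro powr_mono') auto
  finally have "2 ^ n * (3/4 :: real) ^ p \<le> 2 ^ n * (3/4) powr (real n / 3)" by simp
  also have "2 ^ n * (3/4) powr (real n / 3)
      = (2 powr 3) powr (real n / 3) * (3/4 :: real) powr (real n / 3)"
    by (simp add: powr_powr powr_realpow del: powr_numeral)
  also have "\<dots> = (2 powr 3 * (3/4)) powr (real n / 3)"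
    by (rule powr_mult[symmetric])
  also have "(2::real) powr 3 * (3/4) = 6" by simp
  finally show ?thesis .
qed

text \<open>The pairs now overlap in chains \<open>x, x + k, x + 2 * k, ...\<close>. Cutting the
  integers into blocks of length \<open>k\<close> and matching each even-numbered block with the
  next one keeps only disjoint pairs.\<close>

lemma card_difference_free_small:
  assumes "0 < k" "2 * k \<le> n"
  shows "real (card (difference_free n (int k))) \<le> 6 powr (real n / 3)"
proof -
  let ?k = "int k"
  define P where "P = {x \<in> {0..int n - ?k - 1}. x mod (2 * ?k) < ?k}"
  have kx: "(?k + x) mod (2 * ?k) = ?k + x mod (2 * ?k)" if "x mod (2 * ?k) < ?k" for x
  proof -
    have "(?k + x) mod (2 * ?k) = (?k + x mod (2 * ?k)) mod (2 * ?k)" by (simp add: mod_add_right_eq)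
    also have "\<dots> = ?k + x mod (2 * ?k)" using that assms by (intro mod_pos_pos_trivial) auto
    finally show ?thesis .
  qed
  have disj: "P \<inter> (+) ?k ` P = {}"
  proof (rule ccontr)
    assume "P \<inter> (+) ?k ` P \<noteq> {}"
    then obtain x where x: "x \<in> P" "?k + x \<in> P" by blast
    then have "?k + x mod (2 * ?k) < ?k" using kx[of x] by (auto simp: P_def)
    moreover have "0 \<le> x mod (2 * ?k)" using assms by (intro pos_mod_sign) simp
    ultimately show False by linarith
  qed
  have finP: "finite P"
    by (rule finite_subset[of _ "{0..int n - ?k - 1}"]) (auto simp: P_def)
  \<comment> \<open>A point that is in no pair has the form \<open>2 * k + x\<close> with \<open>x \<in> P\<close>: this gives \<open>n \<le> 3 * card P\<close>.\<close>
  have "{0..int n - 1} \<subseteq> P \<union> (+) ?k ` P \<union> (+) (2 * ?k) ` P"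
  proof
    fix x assume x: "x \<in> {0..int n - 1}"
    show "x \<in> P \<union> (+) ?k ` P \<union> (+) (2 * ?k) ` P"
    proof (cases "x mod (2 * ?k) < ?k")
      case True
      show ?thesis
      proof (cases "x < 2 * ?k")
        case True
        with \<open>x mod (2 * ?k) < ?k\<close> x have "x < ?k" by simp
        \<comment> \<open>The hypothesis \<open>2 * k \<le> n\<close> places the whole first block
          in \<open>P\<close>.\<close>
        then have "x \<in> P" using x assms by (auto simp: P_def)
        then show ?thesis by simp
      next
        case False
        have "(x - 2 * ?k) mod (2 * ?k) = x mod (2 * ?k)" by simp
        then have "x - 2 * ?k \<in> P" using True False x by (auto simp: P_def)
        then show ?thesis by force
      qed
    next
      case False
      have bound: "x mod (2 * ?k) < 2 * ?k" using assms by (intro pos_mod_bound) simp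
      have "(x - ?k) mod (2 * ?k) = (x mod (2 * ?k) - ?k) mod (2 * ?k)" by (simp add: mod_diff_left_eq)
      also have "\<dots> = x mod (2 * ?k) - ?k"
        using False assms bound by (intro mod_pos_pos_trivial) auto
      also have "\<dots> < ?k" using bound by simp
      finally have "(x - ?k) mod (2 * ?k) < ?k" .
      moreover have "?k \<le> x"
        using False x zmod_le_nonneg_dividend[of x "2 * ?k"] by auto
      ultimately have "x - ?k \<in> P" using x by (auto simp: P_def)
      then show ?thesis by force
    qed
  qed
  then have "card {0..int n - 1} \<le> card (P \<union> (+) ?k ` P \<union> (+) (2 * ?k) ` P)"
    using finP by (intro card_mono) auto
  also have "\<dots> \<le> card P + card ((+) ?k ` P) + card ((+) (2 * ?k) ` P)"
    by (meson add_mono card_Un_le le_refl order_trans)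
  also have "\<dots> = 3 * card P" by (simp add: card_image)
  finally have n: "n \<le> 3 * card P" by simp
  \<comment> \<open>Keeping only the constraints from \<open>P\<close> enlarges the family, so an
    upper bound results.\<close>
  have "card (difference_free n ?k)
      \<le> card {S \<in> Pow {0..int n - 1}. \<forall>x\<in>P. \<not> (x \<in> S \<and> ?k + x \<in> S)}"
    unfolding difference_free_eq by (intro card_mono) auto
  then have "real (card (difference_free n ?k)) \<le> 2 ^ n * (3/4) ^ card P"
    using card_avoiding_pairs_interval[of P n ?k] disj by (fastforce simp: P_def)
  also have "\<dots> \<le> 6 powr (real n / 3)" by (rule two_pow_three_quarters_le[OF n])
  finally show ?thesis .
qed

text \<open>A bound uniform in \<open>k\<close> lets the geometric series be summed over the whole
  range. Below \<open>n / 2\<close> both terms lie between 0 and the bound, so their difference does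
  not exceed it.\<close>

lemma card_difference_free_approx:
  assumes "0 < k" "k < n"
  shows "\<bar>real (card (difference_free n (int k))) - 2 ^ n * (3/4) ^ (n - k)\<bar> \<le> 6 powr (real n / 3)"
proof (cases "n \<le> 2 * k")
  case True
  then show ?thesis using card_difference_free_large assms by simp
next
  case False
  then have "2 ^ n * (3/4 :: real) ^ (n - k) \<le> 6 powr (real n / 3)"
    by (intro two_pow_three_quarters_le) auto
  moreover have "real (card (difference_free n (int k))) \<le> 6 powr (real n / 3)"
    using False assms by (intro card_difference_free_small) auto
  moreover have "0 \<le> 2 ^ n * (3/4 :: real) ^ (n - k)" by simp
  ultimately show ?thesis by linarith
qed

section \<open>Exchanging the order of summation\<close>

lemma sum_even_symmetric_interval:
  fixes g :: "int \<Rightarrow> real"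
  assumes "\<And>d. g (- d) = g d"
  shows "(\<Sum>d = - int m..int m. g d) = g 0 + 2 * (\<Sum>k = 1..m. g (int k))"
proof (induction m)
  case (Suc m)
  have "{- int (Suc m)..int (Suc m)} = insert (- int (Suc m)) (insert (int (Suc m)) {- int m..int m})"
    by auto
  then show ?case using Suc assms[of "int (Suc m)"] by simp
qed simp

lemma sum_card_difference_set:
  assumes "n > 0"
  shows "real (\<Sum>S\<in>Pow {0..int n - 1}. card (difference_set S))
    = (2 * real n - 1) * 2 ^ n - 1 - 2 * (\<Sum>k = 1..n - 1. real (card (difference_free n (int k))))"
proof -
  let ?A = "Pow {0..int n - 1}"
  let ?D = "{- int (n - 1)..int (n - 1)}"
  have cA: "card ?A = 2 ^ n" by (simp add: card_Pow)
  have sub: "difference_set S \<subseteq> ?D" if "S \<in> ?A" for S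
  proof
    fix d assume "d \<in> difference_set S"
    then obtain a b where ab: "d = a - b" "a \<in> S" "b \<in> S" by (auto simp: difference_set_def)
    then have "a \<in> {0..int n - 1}" "b \<in> {0..int n - 1}" using that by blast+
    then show "d \<in> ?D" using ab(1) assms by (auto simp: of_nat_diff)
  qed
  have "(\<Sum>S\<in>?A. card (difference_set S)) = (\<Sum>S\<in>?A. \<Sum>d\<in>{d\<in>?D. d \<in> difference_set S}. 1)"
  proof (rule sum.cong[OF refl])
    fix S assume "S \<in> ?A"
    then have "{d\<in>?D. d \<in> difference_set S} = difference_set S" using sub by blast
    then show "card (difference_set S) = (\<Sum>d\<in>{d\<in>?D. d \<in> difference_set S}. 1)" by simp
  qed
  also have "\<dots> = (\<Sum>d\<in>?D. \<Sum>S\<in>{S\<in>?A. d \<in> difference_set S}. 1)"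
    by (rule sum.swap_restrict) auto
  finally have "real (\<Sum>S\<in>?A. card (difference_set S))
      = (\<Sum>d\<in>?D. real (card {S\<in>?A. d \<in> difference_set S}))" by simp
  also have "\<dots> = (\<Sum>d\<in>?D. 2 ^ n - real (card (difference_free n d)))"
  proof (rule sum.cong[OF refl])
    fix d
    have "{S\<in>?A. d \<in> difference_set S} \<union> difference_free n d = ?A"
      "{S\<in>?A. d \<in> difference_set S} \<inter> difference_free n d = {}"
      by (auto simp: difference_free_def)
    then have "card {S\<in>?A. d \<in> difference_set S} + card (difference_free n d) = 2 ^ n"
      using card_Un_disjoint[of "{S\<in>?A. d \<in> difference_set S}" "difference_free n d"] cA
      by (simp add: finite_difference_free)
    then have "real (card {S\<in>?A. d \<in> difference_set S} + card (difference_free n d)) = 2 ^ n"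
      by simp
    then show "real (card {S\<in>?A. d \<in> difference_set S}) = 2 ^ n - real (card (difference_free n d))"
      by simp
  qed
  \<comment> \<open>The difference 0 is missed by the empty set only, which gives
    \<open>2 ^ n - 1\<close>; the others pair up as \<open>k\<close> and \<open>- k\<close>.\<close>
  also have "\<dots> = 2 ^ n - 1 + 2 * (\<Sum>k = 1..n - 1. 2 ^ n - real (card (difference_free n (int k))))"
    by (subst sum_even_symmetric_interval) (auto simp: difference_free_uminus difference_free_0)
  also have "\<dots> = (2 * real n - 1) * 2 ^ n - 1
      - 2 * (\<Sum>k = 1..n - 1. real (card (difference_free n (int k))))"
    using assms by (simp add: sum_subtractf of_nat_diff algebra_simps)
  finally show ?thesis .
qed

section \<open>The geometric series and the final estimate\<close>

text \<open>The full series has sum 3, and its tail from exponent \<open>n\<close> on is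
  \<open>4 * (3/4) ^ n\<close>.\<close>

lemma sum_three_quarters_powers:
  assumes "n > 0"
  shows "(\<Sum>k = 1..n - 1. (3/4 :: real) ^ (n - k)) = 3 - 4 * (3/4) ^ n"
proof -
  have "(\<Sum>k = 1..n - 1. (3/4 :: real) ^ (n - k)) = (\<Sum>j = 1..n - 1. (3/4) ^ j)"
    by (rule sum.reindex_bij_witness[of _ "\<lambda>j. n - j" "\<lambda>k. n - k"]) (use assms in auto)
  also have "\<dots> = 3 - 4 * (3/4) ^ n"
  proof -
    have "(\<Sum>j = 1..m. (3/4 :: real) ^ j) = 3 - 4 * (3/4) ^ Suc m" for m
      by (induction m) auto
    then show ?thesis using assms by (metis Suc_pred')
  qed
  finally show ?thesis .
qed

theorem theorem18:
  "\<exists>C::real. \<forall>n::nat. n > 0 \<longrightarrow>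
     \<bar>real (\<Sum>S\<in>Pow {0..int n - 1}. card (difference_set S))
        - 2 ^ n * (2 * real n - 7)\<bar>
     \<le> C * (real n * 6 powr (real n / 3))"
proof (intro exI[of _ 9] allI impI)
  fix n :: nat assume n: "n > 0"
  define E where "E = 6 powr (real n / 3)"
  define M where "M k = real (card (difference_free n (int k)))" for k
  \<comment> \<open>The tail of the series, scaled by \<open>2 ^ n\<close>, is \<open>4 * G\<close>;
    it is absorbed into the error.\<close>
  define G where "G = (2::real) ^ n * (3/4) ^ n"
  have E1: "1 \<le> E" unfolding E_def by (intro ge_one_powr_ge_zero) auto
  have G: "0 \<le> G" "G \<le> E"
    using two_pow_three_quarters_le[of n n] by (auto simp: G_def E_def)
  have "\<bar>(\<Sum>k = 1..n - 1. M k) - (\<Sum>k = 1..n - 1. 2 ^ n * (3/4) ^ (n - k))\<bar>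
      \<le> (\<Sum>k = 1..n - 1. \<bar>M k - 2 ^ n * (3/4) ^ (n - k)\<bar>)"
    unfolding sum_subtractf[symmetric] by (rule sum_abs)
  also have "\<dots> \<le> (\<Sum>k = 1..n - 1. E)"
    unfolding M_def E_def by (intro sum_mono card_difference_free_approx) auto
  also have "\<dots> = real n * E - E" using n by (simp add: of_nat_diff algebra_simps)
  also have "(\<Sum>k = 1..n - 1. 2 ^ n * (3/4 :: real) ^ (n - k)) = 3 * 2 ^ n - 4 * G"
    unfolding sum_distrib_left[symmetric] sum_three_quarters_powers[OF n]
    by (simp add: G_def algebra_simps)
  finally have M: "\<bar>(\<Sum>k = 1..n - 1. M k) - (3 * 2 ^ n - 4 * G)\<bar> \<le> real n * E - E" .
  have "real (\<Sum>S\<in>Pow {0..int n - 1}. card (difference_set S)) - 2 ^ n * (2 * real n - 7)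
      = 6 * 2 ^ n - 1 - 2 * (\<Sum>k = 1..n - 1. M k)"
    unfolding sum_card_difference_set[OF n] M_def by (simp add: algebra_simps)
  moreover have "E \<le> real n * E" using n E1 by simp
  \<comment> \<open>The quantity equals \<open>8 * G - 1 - 2 * e\<close> with
    \<open>\<bar>e\<bar> \<le> real n * E - E\<close>. Its absolute value is at most
    \<open>8 * E + 1 + 2 * (real n * E - E)\<close>, hence at most
    \<open>7 * E + 2 * (real n * E)\<close>; this yields the constant 9.\<close>
  ultimately have "\<bar>real (\<Sum>S\<in>Pow {0..int n - 1}. card (difference_set S))
      - 2 ^ n * (2 * real n - 7)\<bar> \<le> 9 * (real n * E)"
    using M G E1 by linarith
  then show "\<bar>real (\<Sum>S\<in>Pow {0..int n - 1}. card (difference_set S)) - 2 ^ n * (2 * real n - 7)\<bar>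
      \<le> 9 * (real n * 6 powr (real n / 3))"
    by (simp only: E_def)
qed

end
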